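(* Let $\Pi=\mathbb{R}/\mathbb{Z}$ be the circle, let $a,b,c\in C^0(\Pi)$ with $a>0$, and assume that $b$ is separated from $0$ on $\Pi$ (i.e. $b(x)\ne0$ for all $x\in\Pi$). For $\epsilon>0$ let $\lambda_\epsilon$ be the principal eigenvalue of the operator $L_\epsilon u=\epsilon\,a\,u''+b\,u'+c\,u$ on $\Pi$. Then $$\lim_{\epsilon\to0}\lambda_\epsilon=\left(\int_0^1\frac{c(s)}{b(s)}\,ds\right)\Big/\left(\int_0^1\frac{1}{b(s)}\,ds\right).$$
   Context: The principal eigenvalue of $L_\epsilon$ is the eigenvalue with maximal real part (it is real, and admits a positive eigenfunction in $C^2(\Pi)$). *)

theory Defs
  imports "HOL-Analysis.Analysis" "HOL-Library.Periodic_Fun"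
begin

text \<open>
  Functions on the circle \<open>\<real>/\<int>\<close> are represented by 1-periodic functions on the real line.
\<close>

definition C0_circle :: "(real \<Rightarrow> 'a::topological_space) \<Rightarrow> bool" where
  "C0_circle f \<longleftrightarrow> periodic_fun_simple' f \<and> continuous_on UNIV f"

definition deriv1 :: "(real \<Rightarrow> 'a::real_normed_vector) \<Rightarrow> real \<Rightarrow> 'a" where
  "deriv1 u = (\<lambda>x. vector_derivative u (at x))"

definition C2_circle :: "(real \<Rightarrow> 'a::real_normed_vector) \<Rightarrow> bool" where
  "C2_circle u \<longleftrightarrow> periodic_fun_simple' u \<and> (\<forall>x. u differentiable (at x)) \<and>
     (\<forall>x. deriv1 u differentiable (at x)) \<and> continuous_on UNIV (deriv1 (deriv1 u))"

text \<open>
  The operator has real coefficients but acts on complex-valued functions, since its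
  spectrum is complex.
\<close>

definition L_op ::
  "(real \<Rightarrow> real) \<Rightarrow> (real \<Rightarrow> real) \<Rightarrow> (real \<Rightarrow> real) \<Rightarrow> real \<Rightarrow> (real \<Rightarrow> complex) \<Rightarrow> real \<Rightarrow> complex"
where
  "L_op a b c \<epsilon> u =
     (\<lambda>x. (\<epsilon> * a x) *\<^sub>R deriv1 (deriv1 u) x + b x *\<^sub>R deriv1 u x + c x *\<^sub>R u x)"

definition is_eigenvalue ::
  "(real \<Rightarrow> real) \<Rightarrow> (real \<Rightarrow> real) \<Rightarrow> (real \<Rightarrow> real) \<Rightarrow> real \<Rightarrow> complex \<Rightarrow> bool"
where
  "is_eigenvalue a b c \<epsilon> \<nu> \<longleftrightarrow>
     (\<exists>u. C2_circle u \<and> (\<exists>x. u x \<noteq> 0) \<and> (\<forall>x. L_op a b c \<epsilon> u x = \<nu> * u x))"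

definition is_principal_eigenvalue ::
  "(real \<Rightarrow> real) \<Rightarrow> (real \<Rightarrow> real) \<Rightarrow> (real \<Rightarrow> real) \<Rightarrow> real \<Rightarrow> complex \<Rightarrow> bool"
where
  "is_principal_eigenvalue a b c \<epsilon> \<nu> \<longleftrightarrow>
     is_eigenvalue a b c \<epsilon> \<nu> \<and> (\<forall>\<mu>. is_eigenvalue a b c \<epsilon> \<mu> \<longrightarrow> Re \<mu> \<le> Re \<nu>)"

text \<open>
  The principal eigenvalue is kept complex: that it exists, is unique and is real are
  facts about the operator and are not built into the definition.
\<close>

definition principal_eigenvalue ::
  "(real \<Rightarrow> real) \<Rightarrow> (real \<Rightarrow> real) \<Rightarrow> (real \<Rightarrow> real) \<Rightarrow> real \<Rightarrow> complex"
where
  "principal_eigenvalue a b c \<epsilon> = (THE \<nu>. is_principal_eigenvalue a b c \<epsilon> \<nu>)"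

end

theory Submission
  imports Defs
begin

text \<open>
  Writing a positive eigenfunction as \<open>exp Q\<close> with \<open>Q\<close> periodic and \<open>q = Q'\<close>, the eigenvalue
  equation becomes the Riccati equation \<open>p (q' + q\<^sup>2) + b q + c = \<nu>\<close>, where \<open>p = \<epsilon> a\<close>. Since \<open>b\<close> does
  not vanish, the linear part \<open>q \<mapsto> p q' + b q\<close> is invertible on periodic functions with a bound
  uniform in \<open>\<epsilon>\<close>, and \<open>\<nu>\<close> is the multiplier that makes \<open>q\<close> have mean zero; as \<open>p q\<^sup>2\<close> is small, Banach's
  fixed point theorem solves the equation for small \<open>\<epsilon>\<close>. The maximum principle applied to \<open>|v exp (-Q)|\<^sup>2\<close>
  shows that every other eigenvalue, with eigenfunction \<open>v\<close>, has real part less than \<open>\<nu>\<close>. Finally, for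
  \<open>\<epsilon> = 0\<close> the Riccati equation reads \<open>q = (\<nu> - c) / b\<close>, whose mean vanishes exactly for the claimed
  limit; evaluating the equation at the extrema of \<open>Q - G\<close>, where \<open>G'\<close> is a continuously
  differentiable approximation of this \<open>q\<close>, turns this into a bound for \<open>\<nu>\<close>.
\<close>

section \<open>Continuous functions on the circle\<close>

lemma C0_circle_iff: "C0_circle f \<longleftrightarrow> (\<forall>x. f (x + 1) = f x) \<and> continuous_on UNIV f"
  by (auto simp: C0_circle_def periodic_fun_simple'_def)

lemma C0_circleD:
  assumes "C0_circle f"
  shows "f (x + 1) = f x" "continuous_on S f"
  using assms by (auto simp: C0_circle_iff intro: continuous_on_subset)

lemma C0_circle_frac:
  assumes "C0_circle f" shows "f (frac x) = f x"
proof -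
  interpret periodic_fun_simple' f using assms by (simp add: C0_circle_def)
  show ?thesis using minus_of_int[of x "\<lfloor>x\<rfloor>"] by (simp add: frac_def)
qed

lemma C0_circle_attains_max:
  fixes f :: "real \<Rightarrow> real"
  assumes "C0_circle f"
  obtains m where "\<And>x. f x \<le> f m"
proof -
  obtain m where "\<forall>y\<in>{0..1}. f y \<le> f m"
    using continuous_attains_sup[of "{0..1::real}" f] C0_circleD(2)[OF assms] by auto
  then have "f (frac x) \<le> f m" for x
    using frac_ge_0[of x] frac_lt_1[of x] by (simp add: less_imp_le)
  then show ?thesis using that C0_circle_frac[OF assms] by auto
qed

lemma C0_circle_minus: "C0_circle f \<Longrightarrow> C0_circle (\<lambda>x. - f x :: real)"
  by (auto simp: C0_circle_iff intro: continuous_intros)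

lemma C0_circle_attains_min:
  fixes f :: "real \<Rightarrow> real"
  assumes "C0_circle f"
  obtains m where "\<And>x. f m \<le> f x"
  using C0_circle_attains_max[OF C0_circle_minus[OF assms]] by auto

lemma C0_circle_bounded:
  fixes f :: "real \<Rightarrow> real"
  assumes "C0_circle f"
  obtains M where "M > 0" "\<And>x. \<bar>f x\<bar> \<le> M"
proof -
  obtain m n where "\<And>x. f x \<le> f m" "\<And>x. f n \<le> f x"
    using C0_circle_attains_max[OF assms] C0_circle_attains_min[OF assms] by metis
  then have "\<bar>f x\<bar> \<le> \<bar>f m\<bar> + \<bar>f n\<bar> + 1" for x
    by (smt (verit))
  then show ?thesis by (rule that[rotated]) simp
qed

lemma C0_circle_bounded_away:
  fixes f :: "real \<Rightarrow> real"
  assumes "C0_circle f" "\<And>x. f x \<noteq> 0"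
  obtains \<beta> where "\<beta> > 0" "\<And>x. \<beta> \<le> \<bar>f x\<bar>"
proof -
  have "C0_circle (\<lambda>x. \<bar>f x\<bar>)"
    using assms(1) by (auto simp: C0_circle_iff intro: continuous_intros)
  then obtain m where "\<And>x. \<bar>f m\<bar> \<le> \<bar>f x\<bar>"
    using C0_circle_attains_min by blast
  then show ?thesis using that[of "\<bar>f m\<bar>"] assms(2) by simp
qed

lemma C0_circle_uniformly_continuous:
  fixes f :: "real \<Rightarrow> real"
  assumes f: "C0_circle f" and "\<delta> > 0"
  obtains h where "h > 0" "\<And>x y. \<bar>x - y\<bar> \<le> h \<Longrightarrow> \<bar>f x - f y\<bar> < \<delta>"
proof -
  interpret periodic_fun_simple' f using assms by (simp add: C0_circle_def)
  have "uniformly_continuous_on {-1..2} f"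
    by (intro compact_uniformly_continuous C0_circleD(2)[OF f]) simp
  then obtain d where d: "d > 0"
    "\<And>x y. x \<in> {-1..2} \<Longrightarrow> y \<in> {-1..2} \<Longrightarrow> dist y x < d \<Longrightarrow> dist (f y) (f x) < \<delta>"
    using \<open>\<delta> > 0\<close> unfolding uniformly_continuous_on_def by meson
  \<comment> \<open>Both points are shifted by the floor of \<open>x\<close>: the bound 1 keeps the
    shifted \<open>y\<close> in [-1, 2], and \<open>d/2\<close> turns the weak inequality into a
    strict one.\<close>
  show ?thesis
  proof (rule that[of "min 1 (d/2)"])
    fix x y :: real assume xy: "\<bar>x - y\<bar> \<le> min 1 (d/2)"
    have "dist (f (y - of_int \<lfloor>x\<rfloor>)) (f (x - of_int \<lfloor>x\<rfloor>)) < \<delta>"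
    proof (rule d(2))
      have "0 \<le> x - of_int \<lfloor>x\<rfloor>" "x - of_int \<lfloor>x\<rfloor> < 1" "\<bar>x - y\<bar> \<le> 1" using xy by linarith+
      then show "x - of_int \<lfloor>x\<rfloor> \<in> {-1..2}" "y - of_int \<lfloor>x\<rfloor> \<in> {-1..2}"
        unfolding atLeastAtMost_iff by linarith+
      show "dist (y - of_int \<lfloor>x\<rfloor>) (x - of_int \<lfloor>x\<rfloor>) < d"
        using xy d(1) by (simp add: dist_real_def abs_minus_commute)
    qed
    then show "\<bar>f x - f y\<bar> < \<delta>" by (simp add: minus_of_int dist_real_def)
  qed (use d in auto)
qed

section \<open>Derivatives at extrema and periodicity of antiderivatives\<close>

text \<open>A positive \<open>D\<close> would make \<open>f'\<close> positive just to the right of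
  \<open>m\<close>, and the mean value theorem would lift \<open>f\<close> above its
  maximum.\<close>

lemma DERIV_at_max:
  fixes f f' :: "real \<Rightarrow> real"
  assumes f: "\<And>x. (f has_real_derivative f' x) (at x)"
    and f': "(f' has_real_derivative D) (at m)" and max: "\<And>x. f x \<le> f m"
  shows "f' m = 0" "D \<le> 0"
proof -
  show 0: "f' m = 0" using DERIV_local_max[OF f zero_less_one] max by blast
  show "D \<le> 0"
  proof (rule ccontr)
    assume "\<not> D \<le> 0"
    with DERIV_pos_inc_right[OF f'] 0 obtain d where
      d: "d > 0" "\<And>h. 0 < h \<Longrightarrow> h < d \<Longrightarrow> 0 < f' (m + h)" by auto
    have "\<exists>z. m < z \<and> z < m + d/2 \<and> f (m + d/2) - f m = (m + d/2 - m) * f' z"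
      using MVT2[of m "m + d/2" f f'] f d(1) by simp
    then obtain z where "m < z" "z < m + d/2" "f (m + d/2) - f m = d/2 * f' z" by auto
    moreover have "f' z > 0" using d(2)[of "z - m"] calculation by simp
    ultimately show False using max[of "m + d/2"] d(1)
      by (smt (verit) mult_pos_pos half_gt_zero)
  qed
qed

lemma DERIV_at_min:
  fixes f f' :: "real \<Rightarrow> real"
  assumes f: "\<And>x. (f has_real_derivative f' x) (at x)"
    and f': "(f' has_real_derivative D) (at m)" and min: "\<And>x. f m \<le> f x"
  shows "f' m = 0" "0 \<le> D"
  using DERIV_at_max[of "\<lambda>x. - f x" "\<lambda>x. - f' x" "- D" m] assms
  by (auto intro: DERIV_minus)

lemma DERIV_continuous_on_UNIV:
  fixes f f' :: "real \<Rightarrow> real"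
  assumes "\<And>x. (f has_real_derivative f' x) (at x)"
  shows "continuous_on UNIV f"
  by (intro continuous_at_imp_continuous_on ballI DERIV_isCont[OF assms])

lemma continuous_antiderivative:
  fixes f :: "real \<Rightarrow> real"
  assumes "continuous_on UNIV f"
  obtains F where "\<And>x. (F has_real_derivative f x) (at x)"
proof -
  have "\<exists>F. \<forall>x::real. - \<infinity> < ereal x \<longrightarrow> ereal x < \<infinity> \<longrightarrow> (F has_vector_derivative f x) (at x)"
    using assms by (intro einterval_antiderivative) (simp_all add: continuous_on_eq_continuous_at)
  then show ?thesis using that by (auto simp: has_real_derivative_iff_has_vector_derivative)
qed

text \<open>The function \<open>F (x + 1) - \<theta> * F x\<close> has derivative zero. The factor 1
  serves periodic derivatives, a general \<theta> those carrying an exponential weight.\<close>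

lemma DERIV_multiplier_shift:
  fixes F f :: "real \<Rightarrow> real"
  assumes F: "\<And>x. (F has_real_derivative f x) (at x)" and f: "\<And>x. f (x + 1) = \<theta> * f x"
  shows "F (x + 1) = \<theta> * F x + (F 1 - \<theta> * F 0)"
proof -
  have "((\<lambda>x. F (x + 1) - \<theta> * F x) has_real_derivative 0) (at x)" for x
    using DERIV_diff[OF iffD1[OF DERIV_shift F[of "x + 1"]] DERIV_cmult[OF F[of x], of \<theta>]]
    by (simp add: f)
  then have "F (x + 1) - \<theta> * F x = F (0 + 1) - \<theta> * F 0"
    using DERIV_isconst_all[of "\<lambda>x. F (x + 1) - \<theta> * F x"] by blast
  then show ?thesis by simp
qed

lemma C0_circle_DERIV:
  fixes F f :: "real \<Rightarrow> real"
  assumes F: "\<And>x. (F has_real_derivative f x) (at x)"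
    and f: "\<And>x. f (x + 1) = f x" and eq: "F 1 = F 0"
  shows "C0_circle F"
proof -
  have "F (x + 1) = F x" for x using DERIV_multiplier_shift[of F f 1 x, OF F] f eq by simp
  then show ?thesis using DERIV_continuous_on_UNIV[OF F] by (simp add: C0_circle_iff)
qed

text \<open>By the mean value theorem the increment is a value of \<open>f\<close>. This excludes
  resonance in the linear equation and makes the denominator of the limit nonzero.\<close>

lemma antiderivative_increment_nonzero:
  fixes F f :: "real \<Rightarrow> real"
  assumes F: "\<And>x. (F has_real_derivative f x) (at x)" and f: "\<And>x. f x \<noteq> 0"
  shows "F 1 \<noteq> F 0"
proof -
  have "\<exists>z. 0 < z \<and> z < 1 \<and> F 1 - F 0 = (1 - 0) * f z" by (rule MVT2) (simp_all add: F)
  then obtain z where "F 1 - F 0 = (1 - 0) * f z" by blast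
  then show ?thesis using f[of z] by simp
qed

section \<open>Periodic first-order linear equations and the mean-zero corrector\<close>

text \<open>Variation of constants with integrating factor \<open>exp B\<close>. A constant of
  integration giving a periodic solution exists because the multiplier \<open>\<theta>\<close> of
  \<open>exp B\<close> over one period is not 1, as \<open>\<kappa>\<close> has no zero.\<close>

lemma periodic_linear_ode:
  fixes \<kappa> f :: "real \<Rightarrow> real"
  assumes \<kappa>: "C0_circle \<kappa>" "\<And>x. \<kappa> x \<noteq> 0" and f: "C0_circle f"
  obtains q where "C0_circle q" "\<And>x. (q has_real_derivative (f x - \<kappa> x * q x)) (at x)"
proof -
  obtain B where B: "\<And>x. (B has_real_derivative \<kappa> x) (at x)"
    using continuous_antiderivative C0_circleD(2)[OF \<kappa>(1)] by blast
  have "continuous_on UNIV (\<lambda>x. exp (B x) * f x)"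
    by (intro continuous_intros DERIV_continuous_on_UNIV[OF B] C0_circleD(2)[OF f])
  then obtain H where H: "\<And>x. (H has_real_derivative exp (B x) * f x) (at x)"
    using continuous_antiderivative by blast
  define \<theta> where "\<theta> = exp (B 1 - B 0)"
  have \<theta>: "\<theta> \<noteq> 1" "\<theta> \<noteq> 0"
    using antiderivative_increment_nonzero[OF B \<kappa>(2)] by (auto simp: \<theta>_def)
  have B1: "B (x + 1) = B x + (B 1 - B 0)" for x
    using DERIV_multiplier_shift[of B \<kappa> 1] B C0_circleD(1)[OF \<kappa>(1)] by simp
  have E1: "exp (B (x + 1)) = \<theta> * exp (B x)" for x
    by (simp add: B1 \<theta>_def flip: exp_add)
  define k where "k = H 1 - \<theta> * H 0"
  have H1: "H (x + 1) = \<theta> * H x + k" for x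
    unfolding k_def by (rule DERIV_multiplier_shift[OF H]) (simp add: E1 C0_circleD(1)[OF f])
  \<comment> \<open>Chosen so that \<open>H + d\<close> is multiplied by exactly
    \<open>\<theta>\<close> over one period, like \<open>exp B\<close>; their quotient is then
    periodic.\<close>
  define d where "d = k / (\<theta> - 1)"
  have kd: "k + d = \<theta> * d" using \<theta> by (simp add: d_def field_simps)
  define q where "q = (\<lambda>x. (H x + d) * exp (- B x))"
  have q: "(q has_real_derivative (f x - \<kappa> x * q x)) (at x)" for x
  proof -
    have "(q has_real_derivative
        (exp (B x) * f x) * exp (- B x) + (exp (- B x) * - \<kappa> x) * (H x + d)) (at x)"
      unfolding q_def by (rule derivative_eq_intros H B refl)+ simp
    moreover have "(exp (B x) * f x) * exp (- B x) + (exp (- B x) * - \<kappa> x) * (H x + d) =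
        f x - \<kappa> x * q x"
      by (simp add: q_def exp_minus field_simps)
    ultimately show ?thesis by simp
  qed
  have "q (x + 1) = q x" for x
  proof -
    have "H (x + 1) + d = \<theta> * (H x + d)" using H1[of x] kd by (simp add: algebra_simps)
    then show ?thesis using \<theta> by (simp add: q_def E1 exp_minus)
  qed
  moreover have "continuous_on UNIV q"
    by (rule DERIV_continuous_on_UNIV[OF q])
  ultimately show ?thesis using that q by (auto simp: C0_circle_iff)
qed

text \<open>
  The drift equation with right-hand side \<open>\<nu> - f\<close>, where the constant \<open>\<nu>\<close> makes the
  solution \<open>r\<close> have mean zero, that is, a periodic antiderivative \<open>R\<close>.
\<close>

definition corrector ::
  "(real \<Rightarrow> real) \<Rightarrow> (real \<Rightarrow> real) \<Rightarrow> (real \<Rightarrow> real) \<Rightarrow> real \<Rightarrow> (real \<Rightarrow> real) \<Rightarrow> (real \<Rightarrow> real) \<Rightarrow> bool"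
where
  "corrector p b f \<nu> R r \<longleftrightarrow> C0_circle R \<and> C0_circle r \<and>
     (\<forall>x. (R has_real_derivative r x) (at x)) \<and>
     (\<forall>x. (r has_real_derivative ((\<nu> - f x - b x * r x) / p x)) (at x))"

text \<open>By superposition, with periodic solutions \<open>s\<close> and \<open>t\<close> for the
  right-hand sides 1 and \<open>f\<close>, the candidate is \<open>r = \<nu> * s - t\<close>. Its
  mean vanishes for one choice of \<open>\<nu>\<close>, provided that \<open>s\<close> has nonzero
  mean.\<close>

lemma corrector_exists:
  fixes p b f :: "real \<Rightarrow> real"
  assumes p: "C0_circle p" "\<And>x. p x > 0" and b: "C0_circle b" "\<And>x. b x \<noteq> 0"
    and f: "C0_circle f"
  obtains \<nu> R r where "corrector p b f \<nu> R r"
proof -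
  have p0: "p x \<noteq> 0" for x using p(2)[of x] by simp
  have quot: "C0_circle (\<lambda>x. g x / p x)" if "C0_circle g" for g
    using that p(1) p0 by (auto simp: C0_circle_iff intro: continuous_intros)
  have \<kappa>: "C0_circle (\<lambda>x. b x / p x)" "\<And>x. b x / p x \<noteq> 0" using quot b p0 by auto
  have "C0_circle (\<lambda>x. 1 / p x)" using quot[of "\<lambda>x. 1"] by (simp add: C0_circle_iff)
  from periodic_linear_ode[OF \<kappa> this] obtain s where
    s: "C0_circle s" "\<And>x. (s has_real_derivative (1 / p x - b x / p x * s x)) (at x)" by blast
  from periodic_linear_ode[OF \<kappa> quot[OF f]] obtain t where
    t: "C0_circle t" "\<And>x. (t has_real_derivative (f x / p x - b x / p x * t x)) (at x)" by blast
  obtain \<Sigma> where \<Sigma>: "\<And>x. (\<Sigma> has_real_derivative s x) (at x)"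
    using continuous_antiderivative C0_circleD(2)[OF s(1)] by blast
  obtain T where T: "\<And>x. (T has_real_derivative t x) (at x)"
    using continuous_antiderivative C0_circleD(2)[OF t(1)] by blast
  \<comment> \<open>Otherwise \<open>\<Sigma>\<close> is periodic and has a maximum, where
    \<open>s = 0\<close> and hence \<open>s' = 1 / p > 0\<close>, against the second derivative
    test.\<close>
  have "\<Sigma> 1 \<noteq> \<Sigma> 0"
  proof
    assume "\<Sigma> 1 = \<Sigma> 0"
    then obtain m where "\<And>x. \<Sigma> x \<le> \<Sigma> m"
      using C0_circle_attains_max C0_circle_DERIV[OF \<Sigma>] C0_circleD(1)[OF s(1)] by blast
    from DERIV_at_max[OF \<Sigma> s(2) this] p(2)[of m] show False by (simp add: field_simps)
  qed
  define \<nu> where "\<nu> = (T 1 - T 0) / (\<Sigma> 1 - \<Sigma> 0)"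
  define R where "R = (\<lambda>x. \<nu> * \<Sigma> x - T x)"
  define r where "r = (\<lambda>x. \<nu> * s x - t x)"
  have R: "(R has_real_derivative r x) (at x)" for x
    unfolding R_def r_def by (intro DERIV_diff DERIV_cmult \<Sigma> T)
  have r: "C0_circle r"
    using s t by (auto simp: r_def C0_circle_iff intro!: continuous_intros)
  have "\<nu> * (\<Sigma> 1 - \<Sigma> 0) = T 1 - T 0" using \<open>\<Sigma> 1 \<noteq> \<Sigma> 0\<close> by (simp add: \<nu>_def)
  then have "R 1 = R 0" by (simp add: R_def algebra_simps)
  then have "C0_circle R" using C0_circle_DERIV[OF R] C0_circleD(1)[OF r] by blast
  moreover have "(r has_real_derivative ((\<nu> - f x - b x * r x) / p x)) (at x)" for x
    unfolding r_def by (rule derivative_eq_intros s t refl)+ (use p0 in \<open>simp add: field_simps\<close>)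
  ultimately show ?thesis using that R r by (auto simp: corrector_def)
qed

text \<open>
  The right-hand side \<open>\<nu> - f - b r\<close> reduces to \<open>\<nu> - f\<close> at the extrema of \<open>R\<close>, and vanishes at those
  of \<open>r\<close>.
\<close>

lemma corrector_bounds:
  assumes sol: "corrector p b f \<nu> R r" and p: "\<And>x. p x > 0"
    and b: "\<beta> > 0" "\<And>x. \<beta> \<le> \<bar>b x\<bar>" and f: "\<And>x. \<bar>f x\<bar> \<le> M"
  shows "\<bar>\<nu>\<bar> \<le> M" "\<bar>r x\<bar> \<le> 2 * M / \<beta>"
proof -
  have C0: "C0_circle R" "C0_circle r"
    and R: "\<And>x. (R has_real_derivative r x) (at x)"
    and r: "\<And>x. (r has_real_derivative ((\<nu> - f x - b x * r x) / p x)) (at x)"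
    using sol by (auto simp: corrector_def)
  obtain m where "\<And>x. R x \<le> R m" using C0_circle_attains_max[OF C0(1)] by blast
  from DERIV_at_max[OF R r this] have "\<nu> \<le> f m" using p[of m] by (simp add: field_simps)
  moreover obtain n where "\<And>x. R n \<le> R x" using C0_circle_attains_min[OF C0(1)] by blast
  from DERIV_at_min[OF R r this] have "f n \<le> \<nu>" using p[of n] by (simp add: field_simps)
  ultimately show \<nu>: "\<bar>\<nu>\<bar> \<le> M" using f[of m] f[of n] by linarith
  have crit: "\<bar>r y\<bar> \<le> 2 * M / \<beta>" if "(\<nu> - f y - b y * r y) / p y = 0" for y
  proof -
    have "\<bar>b y * r y\<bar> \<le> 2 * M" using that p[of y] \<nu> f[of y] by (simp; linarith)
    moreover have "\<beta> * \<bar>r y\<bar> \<le> \<bar>b y * r y\<bar>" using b(2)[of y] by (simp add: abs_mult mult_right_mono)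
    ultimately show ?thesis using b(1) by (simp add: field_simps)
  qed
  obtain m where m: "\<And>x. r x \<le> r m" using C0_circle_attains_max[OF C0(2)] by blast
  obtain n where n: "\<And>x. r n \<le> r x" using C0_circle_attains_min[OF C0(2)] by blast
  have "\<bar>r m\<bar> \<le> 2 * M / \<beta>" by (rule crit, rule DERIV_local_max[OF r zero_less_one]) (use m in auto)
  moreover have "\<bar>r n\<bar> \<le> 2 * M / \<beta>"
    by (rule crit, rule DERIV_local_min[OF r zero_less_one]) (use n in auto)
  ultimately show "\<bar>r x\<bar> \<le> 2 * M / \<beta>" using m[of x] n[of x] by linarith
qed

text \<open>Linearity turns the a priori bounds into Lipschitz bounds, which give the contraction
  estimate.\<close>

lemma corrector_diff:
  assumes "corrector p b f \<nu> R r" "corrector p b g \<mu> S s"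
  shows "corrector p b (\<lambda>x. f x - g x) (\<nu> - \<mu>) (\<lambda>x. R x - S x) (\<lambda>x. r x - s x)"
proof -
  have "((\<lambda>x. r x - s x) has_real_derivative
      ((\<nu> - \<mu>) - (f x - g x) - b x * (r x - s x)) / p x) (at x)" for x
  proof -
    have "((\<nu> - \<mu>) - (f x - g x) - b x * (r x - s x)) / p x =
        (\<nu> - f x - b x * r x) / p x - (\<mu> - g x - b x * s x) / p x"
      by (simp add: algebra_simps diff_divide_distrib add_divide_distrib)
    then show ?thesis using assms by (auto simp: corrector_def intro: DERIV_diff)
  qed
  with assms show ?thesis
    by (auto simp: corrector_def C0_circle_iff intro: DERIV_diff continuous_intros)
qed

section \<open>Solving the Riccati equation by a fixed point argument\<close>

text \<open>Uniform convergence implies pointwise convergence, which preserves both conditions.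
  Closedness supplies the complete set for Banach's theorem.\<close>

lemma closed_periodic_bounded_bcontfun:
  "closed {\<phi> :: real \<Rightarrow>\<^sub>C real. (\<forall>x. apply_bcontfun \<phi> (x + 1) = apply_bcontfun \<phi> x) \<and>
     (\<forall>x. \<bar>apply_bcontfun \<phi> x\<bar> \<le> K)}"
  unfolding closed_sequential_limits mem_Collect_eq
proof (intro allI impI conjI)
  fix \<phi> :: "nat \<Rightarrow> real \<Rightarrow>\<^sub>C real" and l x
  assume *: "(\<forall>n. (\<forall>x. \<phi> n (x + 1) = \<phi> n x) \<and> (\<forall>x. \<bar>\<phi> n x\<bar> \<le> K)) \<and> \<phi> \<longlonglongrightarrow> l"
  have lim: "(\<lambda>n. \<phi> n y) \<longlonglongrightarrow> l y" for y
    using * by (intro tendsto_uniform_limitI[OF tendsto_bcontfun_uniform_limit]) auto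
  show "l (x + 1) = l x" using * by (intro LIMSEQ_unique[OF _ lim[of x]]) (use lim[of "x + 1"] in simp)
  show "\<bar>l x\<bar> \<le> K"
    using * by (intro tendsto_upperbound[OF tendsto_rabs[OF lim]]) auto
qed

text \<open>
  The operator \<open>q \<mapsto> r\<close>, where \<open>r\<close> is the mean-zero solution for \<open>f = c + p q\<^sup>2\<close>, maps the ball of
  radius \<open>4 C / \<beta>\<close> into itself and is a contraction there with constant \<open>1/2\<close>.
\<close>

lemma riccati_corrector_exists:
  fixes p b c :: "real \<Rightarrow> real"
  assumes p: "C0_circle p" "\<And>x. p x > 0" "\<And>x. p x \<le> P"
    and b: "C0_circle b" "\<beta> > 0" "\<And>x. \<beta> \<le> \<bar>b x\<bar>"
    and c: "C0_circle c" "C > 0" "\<And>x. \<bar>c x\<bar> \<le> C"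
    and small: "32 * P * C \<le> \<beta>\<^sup>2"
  obtains \<nu> Q q where "corrector p b (\<lambda>x. c x + p x * (q x)\<^sup>2) \<nu> Q q"
proof -
  \<comment> \<open>This is the bound on \<open>r\<close> from \<open>corrector_bounds\<close> when
    \<open>f\<close> is bounded by \<open>2 * C\<close>. The smallness hypothesis becomes
    \<open>8 * P * K \<le> \<beta>\<close>, which serves both for invariance of the ball and for
    contraction.\<close>
  define K where "K = 4 * C / \<beta>"
  have K: "K > 0" "8 * P * K \<le> \<beta>"
    using b(2) c(2) small by (auto simp: K_def field_simps power2_eq_square)
  have P: "P > 0" using p(2,3)[of 0] by simp
  have PK: "P * K\<^sup>2 \<le> C"
  proof -
    have "P * K\<^sup>2 = (8 * P * K) * K / 8" by (simp add: power2_eq_square)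
    also have "\<dots> \<le> \<beta> * K / 8" using K by (intro divide_right_mono mult_right_mono) auto
    also have "\<dots> \<le> C" using b(2) c(2) by (simp add: K_def)
    finally show ?thesis .
  qed
  define S where "S = {\<phi> :: real \<Rightarrow>\<^sub>C real. (\<forall>x. apply_bcontfun \<phi> (x + 1) = apply_bcontfun \<phi> x) \<and>
     (\<forall>x. \<bar>apply_bcontfun \<phi> x\<bar> \<le> K)}"
  define F where "F = (\<lambda>(q :: real \<Rightarrow> real) x. c x + p x * (q x)\<^sup>2)"
  \<comment> \<open>Hilbert choice selects a solution among bounded continuous functions; the
    estimates below hold for whichever corrector is selected.\<close>
  define T where "T = (\<lambda>\<phi> :: real \<Rightarrow>\<^sub>C real.
    SOME \<psi>. \<exists>\<nu> R. corrector p b (F (apply_bcontfun \<phi>)) \<nu> R (apply_bcontfun \<psi>))"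
  have b0: "b x \<noteq> 0" for x using b(2) b(3)[of x] by auto
  have F: "\<bar>F (apply_bcontfun \<phi>) x\<bar> \<le> 2 * C" if "\<phi> \<in> S" for \<phi> x
  proof -
    have "p x * (\<phi> x)\<^sup>2 \<le> P * K\<^sup>2"
      using that p(2,3)[of x] K(1) P by (intro mult_mono) (auto simp: S_def abs_le_square_iff[symmetric])
    moreover have "0 \<le> p x * (\<phi> x)\<^sup>2" using p(2)[of x] by simp
    ultimately show ?thesis using c(3)[of x] PK unfolding F_def by linarith
  qed
  have T: "\<exists>\<nu> R. corrector p b (F (apply_bcontfun \<phi>)) \<nu> R (apply_bcontfun (T \<phi>))" "T \<phi> \<in> S"
    if \<phi>: "\<phi> \<in> S" for \<phi>
  proof -
    have "C0_circle (F (apply_bcontfun \<phi>))"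
      using \<phi> p(1) c(1) by (auto simp: C0_circle_iff F_def S_def intro!: continuous_intros)
    then obtain \<nu> R r where sol: "corrector p b (F (apply_bcontfun \<phi>)) \<nu> R r"
      using corrector_exists[OF p(1,2) b(1) b0] by blast
    have "\<bar>r x\<bar> \<le> K" for x
      using corrector_bounds(2)[OF sol p(2) b(2,3) F[OF \<phi>], of x] by (simp add: K_def)
    then have "r \<in> bcontfun"
      using sol by (intro bcontfun_normI[of _ K]) (auto simp: corrector_def C0_circle_iff)
    then have "\<exists>\<psi> \<nu> R. corrector p b (F (apply_bcontfun \<phi>)) \<nu> R (apply_bcontfun \<psi>)"
      using sol by (metis Bcontfun_inverse)
    then show ex: "\<exists>\<nu> R. corrector p b (F (apply_bcontfun \<phi>)) \<nu> R (apply_bcontfun (T \<phi>))"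
      unfolding T_def by (rule someI_ex)
    then obtain \<nu> R where sol: "corrector p b (F (apply_bcontfun \<phi>)) \<nu> R (apply_bcontfun (T \<phi>))"
      by blast
    have "\<bar>T \<phi> x\<bar> \<le> K" for x
      using corrector_bounds(2)[OF sol p(2) b(2,3) F[OF \<phi>], of x] by (simp add: K_def)
    then show "T \<phi> \<in> S" using sol by (simp add: S_def corrector_def C0_circle_iff)
  qed
  have contraction: "dist (T \<phi>) (T \<psi>) \<le> 1/2 * dist \<phi> \<psi>" if \<phi>: "\<phi> \<in> S" and \<psi>: "\<psi> \<in> S" for \<phi> \<psi>
  proof (rule dist_bound)
    fix x
    define d where "d = dist \<phi> \<psi>"
    \<comment> \<open>Factor the difference of squares. With the constant \<open>\<beta> / 4\<close>
      here, the factor \<open>2 / \<beta>\<close> in \<open>corrector_bounds\<close> yields the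
      contraction constant 1/2.\<close>
    have diff: "\<bar>F (apply_bcontfun \<phi>) y - F (apply_bcontfun \<psi>) y\<bar> \<le> \<beta> / 4 * d" for y
    proof -
      have "\<bar>\<phi> y\<bar> \<le> K" "\<bar>\<psi> y\<bar> \<le> K" using \<phi> \<psi> by (auto simp: S_def)
      then have "\<bar>\<phi> y + \<psi> y\<bar> \<le> 2 * K" by linarith
      moreover have "\<bar>\<phi> y - \<psi> y\<bar> \<le> d"
        using dist_bounded[of \<phi> y \<psi>] by (simp add: d_def dist_real_def)
      ultimately have "\<bar>\<phi> y + \<psi> y\<bar> * \<bar>\<phi> y - \<psi> y\<bar> \<le> 2 * K * d" using K(1) by (intro mult_mono) auto
      then have "p y * (\<bar>\<phi> y + \<psi> y\<bar> * \<bar>\<phi> y - \<psi> y\<bar>) \<le> P * (2 * K * d)"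
        using p(2,3)[of y] P by (intro mult_mono[OF p(3)]) auto
      moreover have "\<bar>F (apply_bcontfun \<phi>) y - F (apply_bcontfun \<psi>) y\<bar> =
          p y * (\<bar>\<phi> y + \<psi> y\<bar> * \<bar>\<phi> y - \<psi> y\<bar>)"
      proof -
        have "F (apply_bcontfun \<phi>) y - F (apply_bcontfun \<psi>) y = p y * ((\<phi> y + \<psi> y) * (\<phi> y - \<psi> y))"
          by (simp add: F_def algebra_simps power2_eq_square)
        then show ?thesis using p(2)[of y] by (simp add: abs_mult)
      qed
      moreover have "P * (2 * K * d) \<le> \<beta> / 4 * d"
        using mult_right_mono[OF K(2), of d] by (simp add: d_def)
      ultimately show ?thesis by linarith
    qed
    obtain \<nu> R \<mu> R' where "corrector p b (F (apply_bcontfun \<phi>)) \<nu> R (apply_bcontfun (T \<phi>))"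
      "corrector p b (F (apply_bcontfun \<psi>)) \<mu> R' (apply_bcontfun (T \<psi>))"
      using T(1) \<phi> \<psi> by meson
    from corrector_bounds(2)[OF corrector_diff[OF this] p(2) b(2,3) diff, of x]
    show "dist (T \<phi> x) (T \<psi> x) \<le> 1/2 * dist \<phi> \<psi>"
      using b(2) by (simp add: dist_real_def d_def)
  qed
  have "complete S" unfolding S_def complete_eq_closed by (rule closed_periodic_bounded_bcontfun)
  moreover have "0 \<in> S" using K(1) by (simp add: S_def)
  ultimately have "\<exists>!\<phi>\<in>S. T \<phi> = \<phi>"
    using T(2) contraction by (intro Banach_fix[of S "1/2"]) auto
  then obtain \<phi> where "\<phi> \<in> S" "T \<phi> = \<phi>" by blast
  then have "\<exists>\<nu> R. corrector p b (\<lambda>x. c x + p x * (\<phi> x)\<^sup>2) \<nu> R (apply_bcontfun \<phi>)"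
    using T(1)[of \<phi>] by (simp add: F_def)
  then show ?thesis using that by blast
qed

section \<open>From the Riccati equation to an eigenfunction\<close>

lemma deriv1_eqI:
  "(\<And>x. (u has_vector_derivative u' x) (at x)) \<Longrightarrow> deriv1 u = u'"
  by (auto simp: deriv1_def vector_derivative_at)

lemma deriv1_works:
  "u differentiable (at x) \<Longrightarrow> (u has_vector_derivative deriv1 u x) (at x)"
  by (simp add: deriv1_def vector_derivative_works)

text \<open>For \<open>u = exp Q\<close> one has \<open>u' = q u\<close> and
  \<open>u'' = (q' + q^2) u\<close>, so multiplying the Riccati equation by \<open>exp Q\<close>
  gives the eigenvalue equation.\<close>

lemma riccati_corrector_is_eigenvalue:
  assumes sol: "corrector (\<lambda>x. \<epsilon> * a x) b (\<lambda>x. c x + \<epsilon> * a x * (q x)\<^sup>2) \<nu> Q q"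
    and a: "C0_circle a" and b: "C0_circle b" and c: "C0_circle c" and p: "\<And>x. \<epsilon> * a x > 0"
  shows "is_eigenvalue a b c \<epsilon> (of_real \<nu>)"
proof -
  define q1 where "q1 = (\<lambda>x. (\<nu> - (c x + \<epsilon> * a x * (q x)\<^sup>2) - b x * q x) / (\<epsilon> * a x))"
  have C0: "C0_circle Q" "C0_circle q"
    and Q: "\<And>x. (Q has_real_derivative q x) (at x)"
    and q: "\<And>x. (q has_real_derivative q1 x) (at x)"
    using sol by (auto simp: corrector_def q1_def)
  have p0: "\<epsilon> * a x \<noteq> 0" for x using p[of x] by (rule less_imp_neq[symmetric])
  define u :: "real \<Rightarrow> complex" where "u = (\<lambda>x. of_real (exp (Q x)))"
  define u1 :: "real \<Rightarrow> complex" where "u1 = (\<lambda>x. of_real (q x * exp (Q x)))"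
  define u2 :: "real \<Rightarrow> complex" where "u2 = (\<lambda>x. of_real ((q1 x + (q x)\<^sup>2) * exp (Q x)))"
  have u: "(u has_vector_derivative u1 x) (at x)" for x
    unfolding u_def u1_def
    by (rule has_vector_derivative_of_real) (auto intro!: derivative_eq_intros Q)
  have u1: "(u1 has_vector_derivative u2 x) (at x)" for x
    unfolding u1_def u2_def
    by (rule has_vector_derivative_of_real)
      (auto intro!: derivative_eq_intros Q q simp: algebra_simps power2_eq_square)
  have d: "deriv1 u = u1" "deriv1 u1 = u2" using u u1 by (auto intro: deriv1_eqI)
  \<comment> \<open>The equation expresses \<open>q'\<close> through continuous functions, which
    makes the second derivative of \<open>u\<close> continuous.\<close>
  have "continuous_on UNIV q1"
    unfolding q1_def
    by (intro continuous_intros C0_circleD(2)[OF a] C0_circleD(2)[OF b] C0_circleD(2)[OF c]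
        C0_circleD(2)[OF C0(2)]) (use p0 in blast)
  then have "continuous_on UNIV u2"
    unfolding u2_def by (intro continuous_intros C0_circleD(2)[OF C0(2)] C0_circleD(2)[OF C0(1)])
  moreover have "periodic_fun_simple' u"
    using C0_circleD(1)[OF C0(1)] by (auto simp: periodic_fun_simple'_def u_def)
  ultimately have "C2_circle u"
    using u u1 by (auto simp: C2_circle_def d intro: differentiableI_vector)
  moreover have "u 0 \<noteq> 0" by (simp add: u_def)
  moreover have "L_op a b c \<epsilon> u x = of_real \<nu> * u x" for x
  proof -
    have "\<epsilon> * a x * q1 x = \<nu> - (c x + \<epsilon> * a x * (q x)\<^sup>2) - b x * q x"
      unfolding q1_def using p0[of x] by simp
    then have "\<epsilon> * a x * (q1 x + (q x)\<^sup>2) + b x * q x + c x = \<nu>" by (simp add: algebra_simps)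
    then have "\<epsilon> * a x * ((q1 x + (q x)\<^sup>2) * exp (Q x)) + b x * (q x * exp (Q x)) + c x * exp (Q x) =
      \<nu> * exp (Q x)"
      by (simp only: mult.assoc[symmetric] distrib_right[symmetric])
    then show ?thesis
      unfolding L_op_def d
      unfolding u_def u1_def u2_def scaleR_conv_of_real of_real_mult[symmetric]
        of_real_add[symmetric] of_real_eq_iff .
  qed
  ultimately show ?thesis unfolding is_eigenvalue_def by blast
qed

section \<open>Maximum principle and identification of the principal eigenvalue\<close>

lemma DERIV_inner_self:
  fixes w w' :: "real \<Rightarrow> complex"
  assumes "(w has_vector_derivative w' x) (at x)"
  shows "((\<lambda>x. w x \<bullet> w x) has_real_derivative 2 * (w x \<bullet> w' x)) (at x)"
  using bounded_bilinear.has_vector_derivative[OF bounded_bilinear_inner assms assms]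
  by (simp add: has_real_derivative_iff_has_vector_derivative inner_commute)

text \<open>
  In one dimension the strong maximum principle is the monotonicity of \<open>f' exp (\<integral> k)\<close>, which
  vanishes at a maximum \<open>m\<close> and again at \<open>m + 1\<close>.
\<close>

lemma periodic_subsolution:
  fixes f f1 f2 k :: "real \<Rightarrow> real"
  assumes f: "\<And>x. (f has_real_derivative f1 x) (at x)"
    and f1: "\<And>x. (f1 has_real_derivative f2 x) (at x)"
    and k: "continuous_on UNIV k" and sub: "\<And>x. f2 x + k x * f1 x \<ge> 0"
    and max: "\<And>x. f x \<le> f m" and per: "f (m + 1) = f m"
    and y: "y \<in> {m<..<m+1}"
  shows "f1 y = 0" "f2 y = 0" "f y = f m"
proof -
  obtain B where B: "\<And>x. (B has_real_derivative k x) (at x)"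
    using continuous_antiderivative[OF k] by blast
  define G where "G = (\<lambda>x. f1 x * exp (B x))"
  have G: "(G has_real_derivative (f2 x + k x * f1 x) * exp (B x)) (at x)" for x
    unfolding G_def by (auto intro!: derivative_eq_intros B f1 simp: algebra_simps)
  have mono: "G s \<le> G t" if "s \<le> t" for s t
    using that by (rule DERIV_nonneg_imp_nondecreasing) (use G sub in \<open>blast intro: mult_nonneg_nonneg exp_ge_zero\<close>)
  have "f1 m = 0" using DERIV_at_max(1)[OF f f1 max] .
  moreover have "f1 (m + 1) = 0"
    using DERIV_at_max(1)[OF f f1, of "m + 1"] max per by simp
  ultimately have "G m = 0" "G (m + 1) = 0" by (auto simp: G_def)
  then have "G x = 0" if "x \<in> {m..m+1}" for x
    using mono[of m x] mono[of x "m + 1"] that by auto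
  then have zero: "f1 x = 0" if "x \<in> {m..m+1}" for x using that by (simp add: G_def)
  show "f1 y = 0" using zero y by simp
  \<comment> \<open>Since \<open>y\<close> is interior to the period, \<open>f1\<close> vanishes on
    a neighbourhood of it.\<close>
  show "f2 y = 0"
  proof (rule DERIV_local_const[OF f1])
    show "0 < min (y - m) (m + 1 - y)" using y by simp
    show "\<forall>z. \<bar>y - z\<bar> < min (y - m) (m + 1 - y) \<longrightarrow> f1 y = f1 z"
      using zero y by (auto simp: abs_if split: if_splits)
  qed
  have "\<exists>z. m < z \<and> z < y \<and> f y - f m = (y - m) * f1 z"
    using y f by (intro MVT2) auto
  then show "f y = f m" using zero y by auto
qed

text \<open>With the real inner product on the complex plane, only the real part of an eigenvalue
  enters the equation for the squared modulus.\<close>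

lemma inner_mult_left_complex: "w \<bullet> (z * w) = Re z * (w \<bullet> w)" for z w :: complex
  by (simp add: inner_complex_def algebra_simps)

text \<open>
  The quotient \<open>w\<close> of an eigenfunction by \<open>exp Q\<close> satisfies an equation without zeroth order
  coefficient on the left, so that \<open>|w|\<^sup>2\<close> obeys a maximum principle.
\<close>

lemma eigenvalue_Re_le:
  assumes sol: "corrector (\<lambda>x. \<epsilon> * a x) b (\<lambda>x. c x + \<epsilon> * a x * (q x)\<^sup>2) \<nu> Q q"
    and a: "C0_circle a" and b: "C0_circle b" and p: "\<And>x. \<epsilon> * a x > 0"
    and ev: "is_eigenvalue a b c \<epsilon> \<mu>"
  shows "Re \<mu> \<le> \<nu>" "Re \<mu> = \<nu> \<Longrightarrow> \<mu> = of_real \<nu>"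
proof -
  define q1 where "q1 = (\<lambda>x. (\<nu> - (c x + \<epsilon> * a x * (q x)\<^sup>2) - b x * q x) / (\<epsilon> * a x))"
  have C0: "C0_circle Q" "C0_circle q"
    and Q: "\<And>x. (Q has_real_derivative q x) (at x)"
    and q: "\<And>x. (q has_real_derivative q1 x) (at x)"
    using sol by (auto simp: corrector_def q1_def)
  have p0: "\<epsilon> * a x \<noteq> 0" for x using p[of x] by (rule less_imp_neq[symmetric])
  obtain v z where v: "C2_circle v" "v z \<noteq> 0" "\<And>x. L_op a b c \<epsilon> v x = \<mu> * v x"
    using ev by (auto simp: is_eigenvalue_def)
  define v1 where "v1 = deriv1 v"
  define v2 where "v2 = deriv1 v1"
  have dv: "(v has_vector_derivative v1 x) (at x)" "(v1 has_vector_derivative v2 x) (at x)" for x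
    using v(1) unfolding C2_circle_def v1_def v2_def by (auto intro: deriv1_works)
  define w where "w = (\<lambda>x. exp (- Q x) *\<^sub>R v x)"
  define w1 where "w1 = (\<lambda>x. exp (- Q x) *\<^sub>R (v1 x - q x *\<^sub>R v x))"
  define w2 where "w2 = (\<lambda>x. exp (- Q x) *\<^sub>R
    (v2 x - (2 * q x) *\<^sub>R v1 x + ((q x)\<^sup>2 - q1 x) *\<^sub>R v x))"
  have E: "((\<lambda>x. exp (- Q x)) has_real_derivative - q x * exp (- Q x)) (at x)" for x
    by (auto intro!: derivative_eq_intros Q)
  have w: "(w has_vector_derivative w1 x) (at x)" for x
    unfolding w_def w1_def
    by (rule has_vector_derivative_eq_rhs[OF has_vector_derivative_scaleR[OF E dv(1)]])
      (simp add: algebra_simps)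
  have w1: "(w1 has_vector_derivative w2 x) (at x)" for x
    unfolding w1_def w2_def
    by (rule has_vector_derivative_eq_rhs[OF has_vector_derivative_scaleR[OF E
          has_vector_derivative_diff[OF dv(2) has_vector_derivative_scaleR[OF q dv(1)]]]])
      (simp add: algebra_simps power2_eq_square scaleR_conv_of_real)
  \<comment> \<open>The Riccati equation replaces the zeroth order coefficient left by the
    substitution \<open>v = exp Q w\<close> with the constant \<open>\<nu>\<close>.\<close>
  have eq: "(\<epsilon> * a x) *\<^sub>R w2 x + (b x + 2 * \<epsilon> * a x * q x) *\<^sub>R w1 x = (\<mu> - of_real \<nu>) * w x" for x
  proof -
    have "\<epsilon> * a x * q1 x = \<nu> - (c x + \<epsilon> * a x * (q x)\<^sup>2) - b x * q x"
      unfolding q1_def using p0[of x] by simp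
    then have "\<epsilon> * a x * ((q x)\<^sup>2 - q1 x) = c x + 2 * (\<epsilon> * a x) * (q x)\<^sup>2 + b x * q x - \<nu>"
      by (simp add: algebra_simps)
    moreover have "(\<epsilon> * a x) *\<^sub>R w2 x + (b x + 2 * \<epsilon> * a x * q x) *\<^sub>R w1 x = exp (- Q x) *\<^sub>R
        ((\<epsilon> * a x) *\<^sub>R v2 x + b x *\<^sub>R v1 x +
         (\<epsilon> * a x * ((q x)\<^sup>2 - q1 x) - (b x + 2 * \<epsilon> * a x * q x) * q x) *\<^sub>R v x)"
      by (simp add: w1_def w2_def algebra_simps)
    ultimately have "(\<epsilon> * a x) *\<^sub>R w2 x + (b x + 2 * \<epsilon> * a x * q x) *\<^sub>R w1 x = exp (- Q x) *\<^sub>R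
        ((\<epsilon> * a x) *\<^sub>R v2 x + b x *\<^sub>R v1 x + (c x - \<nu>) *\<^sub>R v x)"
      by (simp add: algebra_simps power2_eq_square)
    also have "(\<epsilon> * a x) *\<^sub>R v2 x + b x *\<^sub>R v1 x + (c x - \<nu>) *\<^sub>R v x = (\<mu> - of_real \<nu>) * v x"
      using v(3)[of x] by (simp add: L_op_def v2_def v1_def algebra_simps scaleR_conv_of_real)
    finally show ?thesis by (simp add: w_def)
  qed
  define f where "f = (\<lambda>x. w x \<bullet> w x)"
  define f1 where "f1 = (\<lambda>x. 2 * (w x \<bullet> w1 x))"
  define f2 where "f2 = (\<lambda>x. 2 * (w x \<bullet> w2 x + w1 x \<bullet> w1 x))"
  have f: "(f has_real_derivative f1 x) (at x)" for x
    unfolding f_def f1_def by (rule DERIV_inner_self[OF w])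
  have f1: "(f1 has_real_derivative f2 x) (at x)" for x
    unfolding f1_def f2_def
    using bounded_bilinear.has_vector_derivative[OF bounded_bilinear_inner w w1, of x]
    by (intro DERIV_cmult) (simp add: has_real_derivative_iff_has_vector_derivative)
  have "v (x + 1) = v x" for x using v(1) by (simp add: C2_circle_def periodic_fun_simple'_def)
  then have f_per: "f (x + 1) = f x" for x
    using C0_circleD(1)[OF C0(1)] by (simp add: f_def w_def)
  have "C0_circle f" using DERIV_continuous_on_UNIV[OF f] f_per by (simp add: C0_circle_iff)
  then obtain m where m: "\<And>x. f x \<le> f m" using C0_circle_attains_max by blast
  have "f z > 0" using v(2) by (simp add: f_def w_def)
  then have fm: "f m > 0" using m[of z] by simp
  \<comment> \<open>The inner product of \<open>eq\<close> with \<open>w\<close>, doubled; the term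
    in \<open>w1\<close> comes from differentiating the squared modulus twice.\<close>
  have ident: "\<epsilon> * a x * f2 x + (b x + 2 * \<epsilon> * a x * q x) * f1 x =
      2 * (\<epsilon> * a x) * (w1 x \<bullet> w1 x) + 2 * (Re \<mu> - \<nu>) * f x" for x
  proof -
    have "w x \<bullet> ((\<epsilon> * a x) *\<^sub>R w2 x + (b x + 2 * \<epsilon> * a x * q x) *\<^sub>R w1 x) = (Re \<mu> - \<nu>) * f x"
      unfolding eq f_def inner_mult_left_complex by simp
    then have "(\<epsilon> * a x) * (w x \<bullet> w2 x) + (b x + 2 * \<epsilon> * a x * q x) * (w x \<bullet> w1 x) = (Re \<mu> - \<nu>) * f x"
      unfolding inner_add_right inner_scaleR_right .
    then show ?thesis by (simp add: f1_def f2_def algebra_simps)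
  qed
  \<comment> \<open>At the maximum of \<open>f\<close> the left side of \<open>ident\<close> is at
    most zero, while the right side would be positive.\<close>
  show "Re \<mu> \<le> \<nu>"
  proof (rule ccontr)
    assume "\<not> Re \<mu> \<le> \<nu>"
    then have "0 < 2 * (Re \<mu> - \<nu>) * f m" using fm by simp
    moreover have "0 \<le> 2 * (\<epsilon> * a m) * (w1 m \<bullet> w1 m)" by (simp only: mult_nonneg_nonneg less_imp_le[OF p] zero_le_numeral inner_ge_zero)
    moreover have "\<epsilon> * a m * f2 m \<le> 0"
      using DERIV_at_max(2)[OF f f1 m] p[of m] by (simp add: mult_nonneg_nonpos)
    ultimately show False using ident[of m] DERIV_at_max(1)[OF f f1 m] by simp
  qed
  \<comment> \<open>In the equality case \<open>f\<close> is a subsolution, hence constant on the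
    open period after \<open>m\<close>. Then \<open>sub\<close> forces \<open>w1 = 0\<close> there,
    and \<open>eq\<close> leaves \<open>(\<mu> - \<nu>) w = 0\<close> at a point where
    \<open>w\<close> is nonzero.\<close>
  assume Re: "Re \<mu> = \<nu>"
  define k where "k = (\<lambda>x. (b x + 2 * \<epsilon> * a x * q x) / (\<epsilon> * a x))"
  have k: "continuous_on UNIV k" unfolding k_def
    by (intro continuous_intros C0_circleD(2)[OF a] C0_circleD(2)[OF b] C0_circleD(2)[OF C0(2)])
      (use p0 in blast)
  have sub: "f2 x + k x * f1 x = 2 * (w1 x \<bullet> w1 x)" for x
  proof -
    have "\<epsilon> * a x * k x = b x + 2 * \<epsilon> * a x * q x" unfolding k_def using p0[of x] by simp
    then have "(\<epsilon> * a x) * (f2 x + k x * f1 x) = (\<epsilon> * a x) * (2 * (w1 x \<bullet> w1 x))"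
      using ident[of x] Re by (simp add: algebra_simps)
    then show ?thesis using p0[of x] by (metis mult_left_cancel)
  qed
  have "f2 x + k x * f1 x \<ge> 0" for x unfolding sub by simp
  note const = periodic_subsolution[OF f f1 k this m f_per]
  have w1_0: "w1 x = 0" if "x \<in> {m<..<m+1}" for x
    using sub[of x] const(1,2)[OF that] by simp
  have y: "m + 1/2 \<in> {m<..<m+1}" by simp
  have "w2 (m + 1/2) = 0"
  proof (rule vector_derivative_unique_at[OF w1])
    show "(w1 has_vector_derivative 0) (at (m + 1/2))"
      by (rule has_vector_derivative_transform_within_open[OF has_vector_derivative_const _ y])
        (use w1_0 in auto)
  qed
  then have "(\<mu> - of_real \<nu>) * w (m + 1/2) = 0" using eq[of "m + 1/2"] w1_0[OF y] by simp
  moreover have "w (m + 1/2) \<noteq> 0" using const(3)[OF y] fm by (auto simp: f_def)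
  ultimately show "\<mu> = of_real \<nu>" by simp
qed

text \<open>The equality case of the maximum principle provides the uniqueness that the definite
  description requires.\<close>

lemma principal_eigenvalue_eqI:
  assumes sol: "corrector (\<lambda>x. \<epsilon> * a x) b (\<lambda>x. c x + \<epsilon> * a x * (q x)\<^sup>2) \<nu> Q q"
    and a: "C0_circle a" and b: "C0_circle b" and c: "C0_circle c" and p: "\<And>x. \<epsilon> * a x > 0"
  shows "principal_eigenvalue a b c \<epsilon> = of_real \<nu>"
  unfolding principal_eigenvalue_def
proof (rule the_equality)
  have ev: "is_eigenvalue a b c \<epsilon> (of_real \<nu>)"
    by (rule riccati_corrector_is_eigenvalue[OF sol a b c p])
  then show "is_principal_eigenvalue a b c \<epsilon> (of_real \<nu>)"
    using eigenvalue_Re_le(1)[OF sol a b p] by (simp add: is_principal_eigenvalue_def)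
  fix \<mu> assume "is_principal_eigenvalue a b c \<epsilon> \<mu>"
  then have "is_eigenvalue a b c \<epsilon> \<mu>" "\<nu> \<le> Re \<mu>"
    using ev by (auto simp: is_principal_eigenvalue_def)
  then show "\<mu> = of_real \<nu>" using eigenvalue_Re_le[OF sol a b p] by (meson antisym)
qed

section \<open>Comparison with smooth test functions and the limit\<close>

text \<open>At an extremum of \<open>Q - G\<close> the first derivatives \<open>q\<close> and
  \<open>g\<close> agree and the second ones are ordered. As \<open>p > 0\<close>, replacing
  \<open>q\<close> by \<open>g\<close> in the Riccati expression changes it in a known
  direction.\<close>

lemma riccati_corrector_comparison:
  assumes sol: "corrector p b (\<lambda>x. c x + p x * (q x)\<^sup>2) \<nu> Q q" and p: "\<And>x. p x > 0"
    and G: "C0_circle G" "\<And>x. (G has_real_derivative g x) (at x)"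
    and g: "\<And>x. (g has_real_derivative g1 x) (at x)"
  obtains m n where "\<nu> \<le> p m * (g1 m + (g m)\<^sup>2) + (b m * g m + c m)"
    "p n * (g1 n + (g n)\<^sup>2) + (b n * g n + c n) \<le> \<nu>"
proof -
  define q1 where "q1 = (\<lambda>x. (\<nu> - (c x + p x * (q x)\<^sup>2) - b x * q x) / p x)"
  have Q0: "C0_circle Q"
    and Q: "\<And>x. (Q has_real_derivative q x) (at x)"
    and q: "\<And>x. (q has_real_derivative q1 x) (at x)"
    using sol by (auto simp: corrector_def q1_def)
  have \<nu>: "\<nu> = p x * (q1 x + (q x)\<^sup>2) + (b x * q x + c x)" for x
  proof -
    have "p x * q1 x = \<nu> - (c x + p x * (q x)\<^sup>2) - b x * q x"
      unfolding q1_def using p[of x] by simp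
    then show ?thesis by (simp add: algebra_simps)
  qed
  have D: "C0_circle (\<lambda>x. Q x - G x)"
    using Q0 G(1) by (auto simp: C0_circle_iff intro: continuous_intros)
  note d = DERIV_diff[OF Q G(2)] DERIV_diff[OF q g]
  obtain m where "\<And>x. Q x - G x \<le> Q m - G m" using C0_circle_attains_max[OF D] by blast
  from DERIV_at_max[OF d this] have "q m = g m" "q1 m \<le> g1 m" by auto
  then have 1: "\<nu> \<le> p m * (g1 m + (g m)\<^sup>2) + (b m * g m + c m)"
    using p[of m] by (subst \<nu>[of m]) simp
  obtain n where "\<And>x. Q n - G n \<le> Q x - G x" using C0_circle_attains_min[OF D] by blast
  from DERIV_at_min[OF d this] have "q n = g n" "g1 n \<le> q1 n" by auto
  then have 2: "p n * (g1 n + (g n)\<^sup>2) + (b n * g n + c n) \<le> \<nu>"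
    using p[of n] by (subst \<nu>[of n]) simp
  show ?thesis using that[OF 1 2] .
qed

text \<open>Here \<open>g\<close> is the sliding mean of \<open>g0\<close> over an interval of
  length \<open>h\<close>, a difference quotient of the antiderivative \<open>F\<close>, which is
  periodic because \<open>g0\<close> has mean zero. Each \<open>g x\<close> is a value of
  \<open>g0\<close> within distance \<open>h\<close> of \<open>x\<close>.\<close>

lemma C1_mean_zero_approximation:
  fixes g0 :: "real \<Rightarrow> real"
  assumes g0: "C0_circle g0" "integral {0..1} g0 = 0" and "\<delta> > 0"
  obtains G g g1 where "C0_circle G" "\<And>x. (G has_real_derivative g x) (at x)"
    "\<And>x. (g has_real_derivative g1 x) (at x)" "C0_circle g" "C0_circle g1" "\<And>x. \<bar>g x - g0 x\<bar> < \<delta>"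
proof -
  obtain h where h: "h > 0" "\<And>x y. \<bar>x - y\<bar> \<le> h \<Longrightarrow> \<bar>g0 x - g0 y\<bar> < \<delta>"
    using C0_circle_uniformly_continuous[OF g0(1) \<open>\<delta> > 0\<close>] by blast
  obtain F where F: "\<And>x. (F has_real_derivative g0 x) (at x)"
    using continuous_antiderivative C0_circleD(2)[OF g0(1)] by blast
  have "(g0 has_integral F 1 - F 0) {0..1}"
    by (rule fundamental_theorem_of_calculus)
      (auto simp: has_real_derivative_iff_has_vector_derivative[symmetric] intro: has_field_derivative_at_within F)
  then have "F 1 = F 0" using g0(2) by (simp add: integral_unique)
  then have F0: "C0_circle F" by (intro C0_circle_DERIV[OF F] C0_circleD(1)[OF g0(1)])
  obtain I where I: "\<And>x. (I has_real_derivative F x) (at x)"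
    using continuous_antiderivative C0_circleD(2)[OF F0] by blast
  \<comment> \<open>The increment of \<open>I\<close> over a period is a constant, possibly nonzero,
    and cancels in the difference quotient \<open>G\<close>.\<close>
  have I1: "I (x + 1) = I x + (I 1 - I 0)" for x
    using DERIV_multiplier_shift[of I F 1 x, OF I] C0_circleD(1)[OF F0] by simp
  define G where "G = (\<lambda>x. (I (x + h) - I x) / h)"
  define g where "g = (\<lambda>x. (F (x + h) - F x) / h)"
  define g1 where "g1 = (\<lambda>x. (g0 (x + h) - g0 x) / h)"
  have G: "(G has_real_derivative g x) (at x)" for x
    unfolding G_def g_def by (rule DERIV_cdivide DERIV_diff iffD1[OF DERIV_shift] I)+
  have g: "(g has_real_derivative g1 x) (at x)" for x
    unfolding g_def g1_def by (rule DERIV_cdivide DERIV_diff iffD1[OF DERIV_shift] F)+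
  have swap: "x + 1 + h = x + h + 1" for x by simp
  have "C0_circle G"
    using DERIV_continuous_on_UNIV[OF G] I1[of "x + h" for x] I1
    by (simp add: C0_circle_iff G_def swap)
  moreover have "C0_circle g"
    using DERIV_continuous_on_UNIV[OF g] C0_circleD(1)[OF F0]
    by (simp add: C0_circle_iff g_def swap)
  moreover have "C0_circle g1"
  proof -
    have "continuous_on UNIV g1"
      unfolding g1_def
      by (intro continuous_intros continuous_on_compose2[OF C0_circleD(2)[OF g0(1), of UNIV]]) (use h in auto)
    then show ?thesis using C0_circleD(1)[OF g0(1)] by (simp add: C0_circle_iff g1_def swap)
  qed
  moreover have "\<bar>g x - g0 x\<bar> < \<delta>" for x
  proof -
    have "\<exists>z. x < z \<and> z < x + h \<and> F (x + h) - F x = (x + h - x) * g0 z"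
      by (rule MVT2) (use h F in auto)
    then obtain z where "x < z" "z < x + h" "g x = g0 z" using h(1) by (auto simp: g_def)
    then show ?thesis using h(2)[of z x] by simp
  qed
  ultimately show ?thesis using that G g by blast
qed

theorem proposition3p1:
  fixes a b c :: "real \<Rightarrow> real"
  assumes "C0_circle a" and "C0_circle b" and "C0_circle c"
    and "\<And>x. a x > 0"
    and "\<And>x. b x \<noteq> 0"
  shows "((\<lambda>\<epsilon>. principal_eigenvalue a b c \<epsilon>) \<longlongrightarrow>
           complex_of_real (integral {0..1} (\<lambda>s. c s / b s) / integral {0..1} (\<lambda>s. 1 / b s)))
         (at_right 0)"
proof (rule tendstoI)
  fix e :: real assume e: "e > 0"
  define \<nu>0 where "\<nu>0 = integral {0..1} (\<lambda>s. c s / b s) / integral {0..1} (\<lambda>s. 1 / b s)"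
  define g0 where "g0 = (\<lambda>x. (\<nu>0 - c x) / b x)"
  have cont: "continuous_on UNIV (\<lambda>x. 1 / b x)" "continuous_on UNIV (\<lambda>x. c x / b x)"
    by (intro continuous_intros C0_circleD(2)[OF assms(2)] C0_circleD(2)[OF assms(3)];
        use assms(5) in blast)+
  obtain F where F: "\<And>x. (F has_real_derivative 1 / b x) (at x)"
    using continuous_antiderivative[OF cont(1)] by blast
  have "((\<lambda>x. 1 / b x) has_integral F 1 - F 0) {0..1}"
    by (rule fundamental_theorem_of_calculus)
      (auto simp: has_real_derivative_iff_has_vector_derivative[symmetric] intro: has_field_derivative_at_within F)
  then have nz: "integral {0..1} (\<lambda>x. 1 / b x) \<noteq> 0"
    using antiderivative_increment_nonzero[OF F] assms(5) by (simp add: integral_unique)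
  have "((\<lambda>x. \<nu>0 * (1 / b x) - c x / b x) has_integral
      \<nu>0 * integral {0..1} (\<lambda>x. 1 / b x) - integral {0..1} (\<lambda>x. c x / b x)) {0..1}"
    by (intro has_integral_diff has_integral_mult_right integrable_integral
        integrable_continuous_real continuous_on_subset[OF cont(1)] continuous_on_subset[OF cont(2)]) auto
  then have mean: "integral {0..1} g0 = 0"
    using nz by (simp add: g0_def \<nu>0_def diff_divide_distrib integral_unique)
  have g0: "C0_circle g0"
    using assms by (auto simp: g0_def C0_circle_iff intro!: continuous_intros)
  obtain A where A: "A > 0" "\<And>x. \<bar>a x\<bar> \<le> A" using C0_circle_bounded[OF assms(1)] by blast
  obtain M where M: "M > 0" "\<And>x. \<bar>b x\<bar> \<le> M" using C0_circle_bounded[OF assms(2)] by blast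
  obtain C where C: "C > 0" "\<And>x. \<bar>c x\<bar> \<le> C" using C0_circle_bounded[OF assms(3)] by blast
  obtain \<beta> where \<beta>: "\<beta> > 0" "\<And>x. \<beta> \<le> \<bar>b x\<bar>"
    using C0_circle_bounded_away[OF assms(2,5)] by blast
  \<comment> \<open>After multiplication by \<open>b\<close>, bounded by \<open>M\<close>, this
    tolerance costs at most \<open>e / 2\<close>.\<close>
  have "e / (2 * M) > 0" using e M(1) by simp
  from C1_mean_zero_approximation[OF g0 mean this] obtain G g g1 where
    G: "C0_circle G" "\<And>x. (G has_real_derivative g x) (at x)"
    and g: "\<And>x. (g has_real_derivative g1 x) (at x)" "C0_circle g" "C0_circle g1"
    and approx: "\<And>x. \<bar>g x - g0 x\<bar> < e / (2 * M)" by metis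
  have near: "\<bar>b x * g x + c x - \<nu>0\<bar> \<le> e / 2" for x
  proof -
    have "b x * g x + c x - \<nu>0 = b x * (g x - g0 x)"
    proof -
      have "b x * g0 x = \<nu>0 - c x" using assms(5)[of x] by (simp add: g0_def)
      then show ?thesis by (simp add: right_diff_distrib)
    qed
    then have "\<bar>b x * g x + c x - \<nu>0\<bar> \<le> M * (e / (2 * M))"
      using M approx[of x] by (simp only: abs_mult) (intro mult_mono, auto)
    then show ?thesis using M(1) by simp
  qed
  have "C0_circle (\<lambda>x. g1 x + (g x)\<^sup>2)"
    using g(2,3) by (auto simp: C0_circle_iff intro!: continuous_intros)
  then obtain N where N: "N > 0" "\<And>x. \<bar>g1 x + (g x)\<^sup>2\<bar> \<le> N" using C0_circle_bounded by blast
  \<comment> \<open>The first entry is the smallness condition of the fixed point argument; the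
    second keeps the second order term below \<open>e / 2\<close>.\<close>
  define \<epsilon>0 where "\<epsilon>0 = min (\<beta>\<^sup>2 / (32 * A * C)) (e / (2 * A * N))"
  have "\<epsilon>0 > 0" using \<beta>(1) A(1) C(1) N(1) e by (simp add: \<epsilon>0_def)
  moreover have "dist (principal_eigenvalue a b c \<epsilon>) (complex_of_real \<nu>0) < e"
    if \<epsilon>: "0 < \<epsilon>" "\<epsilon> < \<epsilon>0" for \<epsilon>
  proof -
    have \<epsilon>1: "32 * (\<epsilon> * A) * C \<le> \<beta>\<^sup>2" and \<epsilon>2: "\<epsilon> * A * N < e / 2"
      using \<epsilon>(2) A(1) C(1) N(1) by (simp_all add: \<epsilon>0_def field_simps)
    have p: "C0_circle (\<lambda>x. \<epsilon> * a x)" "\<And>x. \<epsilon> * a x > 0" "\<And>x. \<epsilon> * a x \<le> \<epsilon> * A"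
      using assms(1,4) A(2) \<epsilon>(1) by (auto simp: C0_circle_iff intro!: continuous_intros intro: order_trans[OF abs_ge_self])
    obtain \<nu> Q q where sol: "corrector (\<lambda>x. \<epsilon> * a x) b (\<lambda>x. c x + \<epsilon> * a x * (q x)\<^sup>2) \<nu> Q q"
      using riccati_corrector_exists[OF p assms(2) \<beta> assms(3) C \<epsilon>1] by blast
    have err: "\<bar>\<epsilon> * a x * (g1 x + (g x)\<^sup>2)\<bar> < e / 2" for x
    proof -
      have "\<bar>\<epsilon> * a x * (g1 x + (g x)\<^sup>2)\<bar> = (\<epsilon> * a x) * \<bar>g1 x + (g x)\<^sup>2\<bar>"
        using abs_of_pos[OF p(2)[of x]] by (simp only: abs_mult)
      also have "\<dots> \<le> (\<epsilon> * A) * N"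
        using N(2)[of x] A(1) \<epsilon>(1) by (intro mult_mono[OF p(3)]) auto
      finally show ?thesis using \<epsilon>2 by simp
    qed
    obtain m n where "\<nu> \<le> \<epsilon> * a m * (g1 m + (g m)\<^sup>2) + (b m * g m + c m)"
      "\<epsilon> * a n * (g1 n + (g n)\<^sup>2) + (b n * g n + c n) \<le> \<nu>"
      using riccati_corrector_comparison[OF sol p(2) G g(1)] by blast
    \<comment> \<open>At \<open>m\<close> and at \<open>n\<close>, one half of \<open>e\<close> pays
      for the second order term and the other for the approximation of \<open>g0\<close>.\<close>
    then have "\<bar>\<nu> - \<nu>0\<bar> < e" using err[of m] err[of n] near[of m] near[of n] by linarith
    then show ?thesis
      using principal_eigenvalue_eqI[OF sol assms(1-3) p(2)]
      by (simp add: dist_norm norm_of_real flip: of_real_diff)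
  qed
  ultimately show "\<forall>\<^sub>F \<epsilon> in at_right 0. dist (principal_eigenvalue a b c \<epsilon>)
      (complex_of_real (integral {0..1} (\<lambda>s. c s / b s) / integral {0..1} (\<lambda>s. 1 / b s))) < e"
    unfolding eventually_at_right_field \<nu>0_def[symmetric] by blast
qed

end
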